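(* Let $0<\alpha<1$. For every integer $r\ge0$, $$\sum_{n=0}^{\infty}\frac{(\alpha)_n(1-\alpha)_n}{(n!)^2}\,\frac{\mathcal H_r(n)}{n+1}=\frac{1}{\alpha(1-\alpha)}\left[\delta_{r,1}+(-1)^r\frac{\sin(\pi\alpha)}{\pi}\,\mathcal B_r\bigl(\Delta_1(\alpha,1-\alpha;1),\ldots,\Delta_r(\alpha,1-\alpha;1)\bigr)\right],$$ where $\delta_{r,1}$ is the Kronecker delta.
   Context: Notation: $(u)_0=1$, $(u)_n=u(u+1)\cdots(u+n-1)$. The complete exponential Bell polynomials $\mathcal B_r$ are defined by $\exp\bigl(\sum_{j\ge1}x_j\frac{t^j}{j!}\bigr)=\sum_{r\ge0}\mathcal B_r(x_1,\ldots,x_r)\frac{t^r}{r!}$, $\mathcal B_0=1$. With $H_n^{(s)}=\sum_{k=1}^n k^{-s}$ ($H_0^{(s)}=0$), $$\mathcal H_r(n)=\mathcal B_r\bigl(H_n^{(1)},1!\,H_n^{(2)},\ldots,(r-1)!\,H_n^{(r)}\bigr).$$ With $\psi=\Gamma'/\Gamma$ and $\psi^{(k)}$ its $k$-th derivative, $$\Delta_j(\alpha,1-\alpha;1)=2\psi^{(j-1)}(1)-\psi^{(j-1)}(1-\alpha)-\psi^{(j-1)}(\alpha).$$ *)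

theory Defs
  imports "HOL-Analysis.Analysis" "HOL-Computational_Algebra.Formal_Power_Series"
begin

text \<open>
  The arguments \<open>x\<^sub>1, x\<^sub>2, \<dots>\<close> of the Bell polynomials are passed as one sequence indexed from 1;
  the value \<open>x 0\<close> is ignored, and \<open>bell_poly r x\<close> depends only on \<open>x 1, \<dots>, x r\<close>.
\<close>

definition bell_arg_fps :: "(nat \<Rightarrow> 'a::field_char_0) \<Rightarrow> 'a fps" where
  "bell_arg_fps x = Abs_fps (\<lambda>j. if j = 0 then 0 else x j / fact j)"

definition bell_poly :: "nat \<Rightarrow> (nat \<Rightarrow> 'a::field_char_0) \<Rightarrow> 'a" where
  "bell_poly r x = fact r * fps_nth (fps_exp 1 oo bell_arg_fps x) r"

lemma bell_poly_generating_function: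
  "fps_exp 1 oo bell_arg_fps x = Abs_fps (\<lambda>r. bell_poly r x / fact r)"
  by (simp add: fps_eq_iff bell_poly_def)

lemma bell_poly_0: "bell_poly 0 x = 1"
  by (simp add: bell_poly_def)

lemma bell_poly_cong:
  assumes "\<And>j. 1 \<le> j \<Longrightarrow> j \<le> r \<Longrightarrow> x j = y j"
  shows "bell_poly r x = bell_poly r y"
proof -
  have eq: "fps_nth (bell_arg_fps x) j = fps_nth (bell_arg_fps y) j" if "j \<le> r" for j
    using assms that by (simp add: bell_arg_fps_def)
  have "fps_nth (bell_arg_fps x ^ i) k = fps_nth (bell_arg_fps y ^ i) k" if "k \<le> r" for i k
    using that
    by (induction i arbitrary: k) (auto simp: fps_mult_nth intro!: sum.cong simp: eq)
  then show ?thesis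
    by (simp add: bell_poly_def fps_compose_nth)
qed

definition gen_harm :: "nat \<Rightarrow> nat \<Rightarrow> real" where
  "gen_harm s n = (\<Sum>k=1..n. 1 / real k ^ s)"

definition bell_harm :: "nat \<Rightarrow> nat \<Rightarrow> real" where
  "bell_harm r n = bell_poly r (\<lambda>j. fact (j - 1) * gen_harm j n)"

text \<open>
  \<open>Polygamma k\<close> is the \<open>k\<close>-th derivative of \<open>\<psi> = \<Gamma>' / \<Gamma>\<close>; this is the sense in which it is used
  below, where all arguments are positive.
\<close>

lemma Polygamma_eq_higher_deriv_psi:
  fixes z :: real
  assumes "z > 0"
  shows "Polygamma k z = (deriv ^^ k) (\<lambda>x. deriv Gamma x / Gamma x) z"
proof -
  have *: "deriv Gamma x / Gamma x = Polygamma 0 x" if "x > 0" for x :: real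
  proof -
    have "x \<notin> \<int>\<^sub>\<le>\<^sub>0"
      using that by (auto elim!: nonpos_Ints_cases)
    then have "deriv Gamma x = Gamma x * Polygamma 0 x"
      by (intro DERIV_imp_deriv has_field_derivative_Gamma)
    then show ?thesis
      using Gamma_real_pos[OF that] by simp
  qed
  have "eventually (\<lambda>x. x > 0) (nhds z)"
    using assms by (intro eventually_nhds_in_open[of "{0<..}", simplified]) auto
  then have "eventually (\<lambda>x. deriv Gamma x / Gamma x = Polygamma 0 x) (nhds z)"
    by eventually_elim (rule *)
  then have "(deriv ^^ k) (\<lambda>x. deriv Gamma x / Gamma x) z = (deriv ^^ k) (Polygamma 0) z"
    by (intro higher_deriv_cong_ev refl)
  also have "\<dots> = Polygamma k z"
    using assms by (subst higher_deriv_Polygamma) (auto elim!: nonpos_Ints_cases)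
  finally show ?thesis by simp
qed

text \<open>\<open>\<Delta>\<^sub>j(\<alpha>, 1 - \<alpha>; 1)\<close>, for \<open>j \<ge> 1\<close>.\<close>

definition Delta :: "real \<Rightarrow> nat \<Rightarrow> real" where
  "Delta \<alpha> j = 2 * Polygamma (j - 1) 1 - Polygamma (j - 1) (1 - \<alpha>) - Polygamma (j - 1) \<alpha>"

end

theory Submission
  imports Defs
begin

unbundle no vec_syntax and fps_syntax

text \<open>
  Everything is read off from generating functions in a formal variable \<open>X\<close> marking \<open>r\<close>. The
  power sums \<open>H_n^(j)\<close> are those of \<open>1, 1/2, \<dots>, 1/n\<close>, so the exponential formula turns the Bell
  polynomials into a product: the series \<open>\<Sum>r. bell_harm r n * X^r / r!\<close> is
  \<open>\<Prod>k=1..n. 1 / (1 - X/k) = n! / (1 - X)_n\<close>. The left hand sides for all \<open>r\<close> together are therefore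
  \<open>\<Sum>n. (\<alpha>)_n (1 - \<alpha>)_n / ((n + 1)! (1 - X)_n)\<close>. Up to a factor \<open>-X / (\<alpha> (1 - \<alpha>))\<close> and a missing initial
  term \<open>1\<close>, this is the hypergeometric series \<open>2F1(\<alpha> - 1, -\<alpha>; -X; 1)\<close>, and Gauss's summation
  theorem evaluates it as
  \<open>1 / (\<alpha> (1 - \<alpha>)) * (X + \<Gamma>(1 - X)^2 / (\<Gamma>(1 - \<alpha> - X) \<Gamma>(\<alpha> - X)))\<close>. The summand \<open>X\<close> is the Kronecker delta,
  and the quotient of Gamma functions expands into the Bell polynomials of \<open>Delta \<alpha>\<close>, with
  \<open>1 / (\<Gamma>(\<alpha>) \<Gamma>(1 - \<alpha>)) = sin (\<pi> \<alpha>) / \<pi>\<close> as constant factor.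

  The proof carries this out for formal power series whose coefficients are convergent real series,
  so that no interchange of summation over \<open>n\<close> and \<open>r\<close> occurs and \<open>X\<close> is never given a value.
  Gauss's theorem is proved in the required case by his own method. With
  \<open>\<Psi>(c) = (c - 1 - X) 2F1(\<alpha> - 1, -\<alpha>; c - 1 - X; 1)\<close>, telescoping yields the contiguous relation
  \<open>(c - X)^2 \<Psi>(c) = (c - \<alpha> - X) (c - 1 + \<alpha> - X) \<Psi>(c + 1)\<close> (\<open>gauss_fps_contiguous\<close>). Iterating it
  \<open>N\<close> times from \<open>c = 1\<close> expresses \<open>\<Psi>(1)\<close> by \<open>\<Psi>(1 + N)\<close> and a finite product of linear factors, which
  the exponential formula writes through the partial sums of the series for the polygamma
  functions (\<open>gauss_fps_factorization\<close>). As \<open>N\<close> tends to infinity these partial sums tend to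
  \<open>(-1)^j * Delta \<alpha> j\<close>, the constant in front tends to \<open>sin (\<pi> \<alpha>) / \<pi>\<close>, and \<open>\<Psi>(1 + N) / N\<close> tends to
  \<open>1\<close> coefficient by coefficient, which proves \<open>gauss_fps_nth\<close>.

  All convergence rests on two estimates: \<open>(\<alpha>)_n (1 - \<alpha>)_n \<le> n!^2 / (n + 1)\<close>, and a bound of order
  \<open>sqrt n / n!\<close> for each coefficient of \<open>1 / (c - X)_n\<close>, uniform in \<open>c \<ge> 1\<close>. They make the
  summands \<open>O(n powr (-3/2))\<close>.
\<close>

section \<open>The exponential generating function of the Bell polynomials\<close>

lemma bell_arg_nth_0 [simp]: "bell_arg_fps x $ 0 = 0"
  by (simp add: bell_arg_fps_def)

definition bell_gf :: "(nat \<Rightarrow> 'a::field_char_0) \<Rightarrow> 'a fps" where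
  "bell_gf x = fps_exp 1 oo bell_arg_fps x"

lemma bell_gf_nth: "bell_gf x $ r = bell_poly r x / fact r"
  by (simp add: bell_gf_def bell_poly_generating_function)

lemma bell_gf_nth_0 [simp]: "bell_gf x $ 0 = 1"
  by (simp add: bell_gf_nth bell_poly_0)

lemma bell_gf_deriv: "fps_deriv (bell_gf x) = bell_gf x * fps_deriv (bell_arg_fps x)"
  by (simp add: bell_gf_def fps_compose_deriv)

text \<open>
  The quotient of two solutions of the same linear first order differential equation is constant.
  A candidate is thus recognised as an exponential by its logarithmic derivative.
\<close>

lemma bell_gf_unique:
  fixes F :: "'a::field_char_0 fps"
  assumes F0: "F $ 0 = 1" and F': "fps_deriv F = F * fps_deriv (bell_arg_fps x)"
  shows "F = bell_gf x"
proof -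
  let ?E = "bell_gf x"
  have inv: "?E * inverse ?E = 1"
    by (intro inverse_mult_eq_1') simp
  have "fps_deriv (F * inverse ?E) * ?E = 0"
  proof -
    have "fps_deriv (?E * inverse ?E) = 0"
      by (simp add: inv)
    then have "?E * (fps_deriv (inverse ?E) + fps_deriv (bell_arg_fps x) * inverse ?E) = 0"
      by (simp add: bell_gf_deriv algebra_simps)
    moreover have "?E \<noteq> 0"
      using bell_gf_nth_0[of x] by fastforce
    ultimately have "fps_deriv (inverse ?E) = - (fps_deriv (bell_arg_fps x) * inverse ?E)"
      by (simp add: eq_neg_iff_add_eq_0)
    then show ?thesis
      by (simp add: F' algebra_simps)
  qed
  moreover have "?E \<noteq> 0"
    using bell_gf_nth_0[of x] by fastforce
  ultimately have "fps_deriv (F * inverse ?E) = 0"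
    by simp
  then have "F * inverse ?E = fps_const ((F * inverse ?E) $ 0)"
    by (simp only: fps_deriv_eq_0_iff)
  then have "F * inverse ?E = 1"
    by (simp add: F0)
  then have "F * (?E * inverse ?E) = ?E"
    by (simp only: mult.left_commute[of F ?E] mult_1_right)
  then show ?thesis
    by (simp only: inv mult_1_right)
qed

lemma bell_gf_add: "bell_gf (\<lambda>j. x j + y j) = bell_gf x * bell_gf y"
proof -
  have "bell_arg_fps (\<lambda>j. x j + y j) = bell_arg_fps x + bell_arg_fps y"
    by (auto simp: fps_eq_iff bell_arg_fps_def add_divide_distrib)
  then show ?thesis
    by (intro bell_gf_unique [symmetric]) (simp_all add: bell_gf_deriv algebra_simps)
qed

lemma bell_gf_zero [simp]: "bell_gf (\<lambda>j. 0) = 1"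
proof -
  have "bell_arg_fps (\<lambda>j. 0 :: 'a) = 0"
    by (auto simp: fps_eq_iff bell_arg_fps_def)
  then show ?thesis
    by (intro bell_gf_unique [symmetric]) simp_all
qed

lemma bell_gf_sum:
  "finite K \<Longrightarrow> bell_gf (\<lambda>j. \<Sum>k\<in>K. x k j) = (\<Prod>k\<in>K. bell_gf (x k))"
  by (induction K rule: finite_induct) (simp_all add: bell_gf_add)

text \<open>
  The exponent is \<open>ln (1 - c X) = - (\<Sum>j\<ge>1. c^j X^j / j)\<close>. Together with additivity this is the
  passage from power sums to products of linear factors.
\<close>

lemma bell_gf_neg_power:
  "bell_gf (\<lambda>j. - (fact (j - 1) * c ^ j)) = 1 - fps_const c * fps_X"
proof -
  let ?G = "Abs_fps (\<lambda>n. c ^ n)"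
  have "fps_deriv (bell_arg_fps (\<lambda>j. - (fact (j - 1) * c ^ j))) = - (fps_const c * ?G)"
    by (rule fps_ext) (simp add: bell_arg_fps_def del: of_nat_Suc)
  moreover have "(1 - fps_const c * fps_X) * ?G = 1"
  proof (rule fps_ext)
    fix n
    show "((1 - fps_const c * fps_X) * ?G) $ n = 1 $ n"
      by (cases n) (simp_all add: left_diff_distrib mult.assoc)
  qed
  ultimately have "(1 - fps_const c * fps_X) *
      fps_deriv (bell_arg_fps (\<lambda>j. - (fact (j - 1) * c ^ j))) = - fps_const c"
    by (simp only: mult_minus_right mult.left_commute[of "1 - fps_const c * fps_X" "fps_const c"] mult_1_right)
  then show ?thesis
    by (intro bell_gf_unique [symmetric]) simp_all
qed

text \<open>
  Alternating the signs of the arguments is the substitution of \<open>-X\<close> for \<open>X\<close>.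
\<close>

lemma bell_poly_alternate: "bell_poly r (\<lambda>j. (-1) ^ j * x j) = (-1) ^ r * bell_poly r x"
proof -
  have "bell_arg_fps (\<lambda>j. (-1) ^ j * x j) = bell_arg_fps x oo (- fps_X)"
    by (auto simp: fps_eq_iff bell_arg_fps_def fps_compose_uminus')
  then have "fps_exp 1 oo bell_arg_fps (\<lambda>j. (-1) ^ j * x j) = (fps_exp 1 oo bell_arg_fps x) oo (- fps_X)"
    by (simp add: fps_compose_assoc)
  then show ?thesis
    by (simp add: bell_poly_def fps_compose_uminus')
qed

section \<open>Coefficientwise limits\<close>

lemma tendsto_fps_mult_nth:
  fixes f g :: "'b \<Rightarrow> 'a::{real_normed_algebra} fps"
  assumes "\<And>i. i \<le> r \<Longrightarrow> ((\<lambda>n. f n $ i) \<longlongrightarrow> F $ i) net"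
      and "\<And>i. i \<le> r \<Longrightarrow> ((\<lambda>n. g n $ i) \<longlongrightarrow> G $ i) net"
  shows "((\<lambda>n. (f n * g n) $ r) \<longlongrightarrow> (F * G) $ r) net"
  unfolding fps_mult_nth using assms by (intro tendsto_intros) auto

text \<open>
  A coefficient of the composition is a polynomial in finitely many coefficients of the exponent.
\<close>

lemma tendsto_bell_gf_nth:
  fixes x :: "nat \<Rightarrow> 'a::{real_normed_field}"
  assumes "\<And>j. j \<ge> 1 \<Longrightarrow> ((\<lambda>n. f n j) \<longlongrightarrow> x j) net"
  shows "((\<lambda>n. bell_gf (f n) $ r) \<longlongrightarrow> bell_gf x $ r) net"
proof -
  have arg: "((\<lambda>n. bell_arg_fps (f n) $ j) \<longlongrightarrow> bell_arg_fps x $ j) net" for j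
    using assms by (cases "j = 0") (auto simp: bell_arg_fps_def intro!: tendsto_intros)
  have "((\<lambda>n. (bell_arg_fps (f n) ^ i) $ k) \<longlongrightarrow> (bell_arg_fps x ^ i) $ k) net" for i k
    by (induction i arbitrary: k) (auto intro!: tendsto_fps_mult_nth arg)
  then show ?thesis
    unfolding bell_gf_def fps_compose_nth by (intro tendsto_intros)
qed

lemma sums_fps_mult_left_nth:
  fixes f :: "nat \<Rightarrow> 'a::{real_normed_algebra} fps"
  assumes "\<And>i. (\<lambda>n. f n $ i) sums (F $ i)"
  shows "(\<lambda>n. (c * f n) $ r) sums ((c * F) $ r)"
  unfolding fps_mult_nth using assms by (intro sums_sum sums_mult)


section \<open>Reciprocals of shifted factorials\<close>

definition lin :: "real \<Rightarrow> real fps" where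
  "lin c = fps_const c - fps_X"

lemma lin_nth: "lin c $ r = (if r = 0 then c else if r = 1 then -1 else 0)"
  by (auto simp: lin_def)

definition inv_poch :: "real \<Rightarrow> nat \<Rightarrow> real fps" where
  "inv_poch c n = (\<Prod>k<n. inverse (lin (c + real k)))"

lemma lin_inverse: "c \<noteq> 0 \<Longrightarrow> inverse (lin c) * lin c = 1"
  by (intro inverse_mult_eq_1) (simp add: lin_nth)

lemma inv_poch_0 [simp]: "inv_poch c 0 = 1"
  by (simp add: inv_poch_def)

lemma inv_poch_Suc:
  assumes "c > 0"
  shows "inv_poch c (Suc n) * lin (c + real n) = inv_poch c n"
  using assms by (simp add: inv_poch_def mult.assoc lin_inverse)

lemma inv_poch_shift:
  assumes "c > 0"
  shows "inv_poch c (Suc n) * lin c = inv_poch (c + 1) n"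
proof -
  have "inv_poch c (Suc n) = inverse (lin c) * inv_poch (c + 1) n"
    unfolding inv_poch_def by (subst prod.lessThan_Suc_shift) (simp add: add_ac)
  then show ?thesis
    using assms lin_inverse[of c] by (simp add: mult_ac)
qed

lemma inv_poch_nth_Suc:
  assumes "c > 0"
  shows "(c + real n) * inv_poch c (Suc n) $ r =
           inv_poch c n $ r + (if r = 0 then 0 else inv_poch c (Suc n) $ (r - 1))"
proof -
  have "(inv_poch c (Suc n) * lin (c + real n)) $ r = inv_poch c n $ r"
    by (simp add: inv_poch_Suc assms)
  then show ?thesis
    by (simp add: lin_def algebra_simps split: if_splits)
qed

text \<open>
  For \<open>c = 1\<close> the coefficients of \<open>n! / (1 - X)_n\<close> are complete homogeneous symmetric functions of
  \<open>1, 1/2, \<dots>, 1/n\<close> and grow like powers of \<open>ln n\<close>; any bound \<open>O(n powr (1 - \<epsilon>))\<close> suffices here.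
  The one with \<open>\<epsilon> = 1/2\<close> follows by evaluating the series at \<open>X = 1/2\<close>: the value
  \<open>n! / (1/2)_n\<close> is of order \<open>sqrt n\<close>, and each coefficient is nonnegative. The
  induction is the direct form of this argument; the radicand \<open>4 n + 1\<close> is chosen so that it also
  covers \<open>n = 0\<close>. A larger \<open>c\<close> only decreases the coefficients.
\<close>

lemma inv_poch_nth_bounds:
  assumes c: "c \<ge> 1"
  shows "0 \<le> inv_poch c n $ r" and "fact n * inv_poch c n $ r \<le> 2 ^ r * sqrt (4 * real n + 1)"
proof -
  have "0 \<le> inv_poch c n $ r \<and> fact n * inv_poch c n $ r \<le> 2 ^ r * sqrt (4 * real n + 1)"
  proof (induction n arbitrary: r)
    case 0
    then show ?case by auto
  next
    case (Suc n)
    note IHn = Suc.IH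
    have le: "real n + 1 \<le> c + real n" and pos: "0 < c + real n"
      using c by auto
    have mono: "sqrt (4 * real n + 1) \<le> sqrt (4 * real (Suc n) + 1)"
      by simp
    \<comment> \<open>After squaring and clearing denominators the two sides differ by exactly 1.\<close>
    have step: "sqrt (4 * real n + 1) \<le> (2 * real n + 1) / (2 * real n + 2) * sqrt (4 * real (Suc n) + 1)"
    proof (rule real_le_lsqrt)
      have "(4 * real n + 1) * (2 * real n + 2)\<^sup>2 \<le> (2 * real n + 1)\<^sup>2 * (4 * real n + 5)"
        by (simp add: power2_eq_square algebra_simps)
      then have "4 * real n + 1 \<le> (2 * real n + 1)\<^sup>2 * (4 * real n + 5) / (2 * real n + 2)\<^sup>2"
        by (simp add: pos_le_divide_eq)
      also have "\<dots> = ((2 * real n + 1) / (2 * real n + 2) * sqrt (4 * real (Suc n) + 1))\<^sup>2"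
        by (simp add: power_mult_distrib power_divide add.commute)
      finally show "4 * real n + 1 \<le> ((2 * real n + 1) / (2 * real n + 2) * sqrt (4 * real (Suc n) + 1))\<^sup>2" .
    qed auto
    show ?case
    proof (induction r)
      case 0
      have eq: "(c + real n) * inv_poch c (Suc n) $ 0 = inv_poch c n $ 0"
        using c by (subst inv_poch_nth_Suc) auto
      have nn: "0 \<le> inv_poch c (Suc n) $ 0"
        using eq Suc.IH[of 0] pos by (metis less_le_not_le linorder_not_less mult_pos_neg)
      have "fact (Suc n) * inv_poch c (Suc n) $ 0 = fact n * ((real n + 1) * inv_poch c (Suc n) $ 0)"
        by (simp add: algebra_simps)
      also have "\<dots> \<le> fact n * inv_poch c n $ 0"
        unfolding eq [symmetric] using le nn by (intro mult_left_mono mult_right_mono) auto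
      also have "\<dots> \<le> sqrt (4 * real n + 1)"
        using Suc.IH[of 0] by simp
      also note mono
      finally show ?case
        unfolding power_0 mult_1_left using nn by (rule conjI[rotated])
    next
      case (Suc r)
      let ?s = "sqrt (4 * real (Suc n) + 1)"
      have eq: "(c + real n) * inv_poch c (Suc n) $ Suc r = inv_poch c n $ Suc r + inv_poch c (Suc n) $ r"
        using c by (subst inv_poch_nth_Suc) auto
      have "0 \<le> (c + real n) * inv_poch c (Suc n) $ Suc r"
        unfolding eq using Suc.IH IHn[of "Suc r"] by simp
      then have nn: "0 \<le> inv_poch c (Suc n) $ Suc r"
        using pos by (simp add: zero_le_mult_iff)
      have "fact (Suc n) * inv_poch c (Suc n) $ Suc r = fact n * ((real n + 1) * inv_poch c (Suc n) $ Suc r)"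
        by (simp add: algebra_simps)
      also have "\<dots> \<le> fact n * (inv_poch c n $ Suc r + inv_poch c (Suc n) $ r)"
        unfolding eq [symmetric] using le nn by (intro mult_left_mono mult_right_mono) auto
      also have "\<dots> = fact n * inv_poch c n $ Suc r + fact (Suc n) * inv_poch c (Suc n) $ r / (real n + 1)"
        by (simp add: field_simps)
      also have "\<dots> \<le> 2 ^ Suc r * sqrt (4 * real n + 1) + 2 ^ r * ?s / (real n + 1)"
        using Suc.IH IHn[of "Suc r"]
        by (intro add_mono divide_right_mono) auto
      also have "\<dots> \<le> 2 ^ Suc r * ((2 * real n + 1) / (2 * real n + 2) * ?s) + 2 ^ r * ?s / (real n + 1)"
        using step by (intro add_right_mono mult_left_mono) auto
      also have "2 ^ r * ?s / (real n + 1) = 2 ^ Suc r * ?s * (1 / (2 * real n + 2))"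
        by (simp add: field_simps)
      also have "2 ^ Suc r * ((2 * real n + 1) / (2 * real n + 2) * ?s) + \<dots> =
          2 ^ Suc r * ?s * ((2 * real n + 1) / (2 * real n + 2) + 1 / (2 * real n + 2))"
        by (simp only: distrib_left mult_ac)
      also have "(2 * real n + 1) / (2 * real n + 2) + 1 / (2 * real n + 2) = 1"
        by (simp add: field_simps)
      finally show ?case
        using nn by simp
    qed
  qed
  then show "0 \<le> inv_poch c n $ r" and "fact n * inv_poch c n $ r \<le> 2 ^ r * sqrt (4 * real n + 1)"
    by auto
qed

section \<open>The hypergeometric series\<close>

definition hyp_coeff :: "real \<Rightarrow> nat \<Rightarrow> real" where
  "hyp_coeff \<alpha> n = pochhammer \<alpha> n * pochhammer (1 - \<alpha>) n / fact (Suc n)"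

lemma hyp_coeff_0 [simp]: "hyp_coeff \<alpha> 0 = 1"
  by (simp add: hyp_coeff_def)

lemma hyp_coeff_Suc: "(real n + 2) * hyp_coeff \<alpha> (Suc n) = (\<alpha> + real n) * (1 - \<alpha> + real n) * hyp_coeff \<alpha> n"
proof -
  have "fact (Suc (Suc n)) = (real n + 2) * fact (Suc n)"
    by (simp add: algebra_simps)
  moreover have "real n + 2 \<noteq> 0"
    by linarith
  ultimately show ?thesis
    by (simp add: hyp_coeff_def pochhammer_Suc mult_ac del: fact_Suc)
qed

text \<open>
  The extreme case is \<open>\<alpha> = 1/2\<close>, where \<open>((1/2)_n / n!)^2\<close> behaves like \<open>1 / (\<pi> n)\<close>.
\<close>

lemma hyp_coeff_bounds:
  assumes "0 < \<alpha>" "\<alpha> < 1"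
  shows "0 \<le> hyp_coeff \<alpha> n" and "hyp_coeff \<alpha> n \<le> fact n / (real n + 1)\<^sup>2"
proof -
  have p: "0 \<le> pochhammer \<alpha> n * pochhammer (1 - \<alpha>) n" for n
    using assms by (simp add: pochhammer_nonneg)
  then show "0 \<le> hyp_coeff \<alpha> n"
    by (simp add: hyp_coeff_def)
  have "pochhammer \<alpha> n * pochhammer (1 - \<alpha>) n * (real n + 1) \<le> (fact n)\<^sup>2"
  proof (induction n)
    case (Suc n)
    have "0 \<le> (\<alpha> - 1 / 2)\<^sup>2"
      by simp
    then have "\<alpha> * (1 - \<alpha>) \<le> 1 / 4"
      by (simp add: power2_eq_square algebra_simps)
    then have "(\<alpha> + real n) * (1 - \<alpha> + real n) \<le> (real n)\<^sup>2 + real n + 1 / 4"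
      by (simp add: power2_eq_square algebra_simps)
    then have "(\<alpha> + real n) * (1 - \<alpha> + real n) * (real n + 2) \<le> ((real n)\<^sup>2 + real n + 1 / 4) * (real n + 2)"
      by (intro mult_right_mono) auto
    also have "\<dots> \<le> (real n + 1) ^ 3"
      by (simp add: power2_eq_square power3_eq_cube algebra_simps)
    finally have step: "(\<alpha> + real n) * (1 - \<alpha> + real n) * (real n + 2) \<le> (real n + 1) ^ 3" .
    have "pochhammer \<alpha> (Suc n) * pochhammer (1 - \<alpha>) (Suc n) * (real (Suc n) + 1) =
        (pochhammer \<alpha> n * pochhammer (1 - \<alpha>) n) * ((\<alpha> + real n) * (1 - \<alpha> + real n) * (real n + 2))"
      by (simp add: pochhammer_Suc algebra_simps)
    also have "\<dots> \<le> (pochhammer \<alpha> n * pochhammer (1 - \<alpha>) n) * (real n + 1) ^ 3"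
      using step p by (intro mult_left_mono) auto
    also have "\<dots> = (pochhammer \<alpha> n * pochhammer (1 - \<alpha>) n * (real n + 1)) * (real n + 1)\<^sup>2"
      by (simp add: power2_eq_square power3_eq_cube)
    also have "\<dots> \<le> (fact n)\<^sup>2 * (real n + 1)\<^sup>2"
      using Suc.IH by (intro mult_right_mono) auto
    also have "\<dots> = (fact (Suc n))\<^sup>2"
      by (simp add: power_mult_distrib add.commute mult.commute)
    finally show ?case .
  qed simp
  then have "pochhammer \<alpha> n * pochhammer (1 - \<alpha>) n \<le> (fact n)\<^sup>2 / (real n + 1)"
    by (simp add: pos_le_divide_eq)
  then have "hyp_coeff \<alpha> n \<le> (fact n)\<^sup>2 / (real n + 1) / fact (Suc n)"
    unfolding hyp_coeff_def by (rule divide_right_mono) simp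
  also have "\<dots> = fact n / (real n + 1)\<^sup>2"
    by (simp add: power2_eq_square add.commute)
  finally show "hyp_coeff \<alpha> n \<le> fact n / (real n + 1)\<^sup>2" .
qed

text \<open>
  This is the summand with index \<open>n + 1\<close> of \<open>2F1(\<alpha> - 1, -\<alpha>; c - 1 - X; 1)\<close>, multiplied by
  \<open>(c - 1 - X) / (\<alpha> (1 - \<alpha>))\<close>. At \<open>c = 1\<close> its coefficients are the summands of the theorem, up to
  factorials of the index of the coefficient.
\<close>

definition hyp_term :: "real \<Rightarrow> real \<Rightarrow> nat \<Rightarrow> real fps" where
  "hyp_term \<alpha> c n = fps_const (hyp_coeff \<alpha> n) * inv_poch c n"

lemma hyp_term_nth_bounds:
  assumes "0 < \<alpha>" "\<alpha> < 1" "c \<ge> 1"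
  shows "0 \<le> hyp_term \<alpha> c n $ r"
    and "hyp_term \<alpha> c n $ r \<le> 2 ^ Suc r * real (Suc n) powr (-3/2)"
proof -
  note w = hyp_coeff_bounds[OF assms(1,2)] and p = inv_poch_nth_bounds[OF assms(3)]
  show "0 \<le> hyp_term \<alpha> c n $ r"
    using w(1) p(1) by (simp add: hyp_term_def)
  have "hyp_term \<alpha> c n $ r \<le> fact n / (real n + 1)\<^sup>2 * inv_poch c n $ r"
    unfolding hyp_term_def fps_mult_left_const_nth by (intro mult_right_mono w(2) p(1))
  also have "\<dots> = (fact n * inv_poch c n $ r) / (real n + 1)\<^sup>2"
    by simp
  also have "\<dots> \<le> (2 ^ r * sqrt (4 * real n + 1)) / (real n + 1)\<^sup>2"
    using p(2) by (intro divide_right_mono) auto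
  also have "sqrt (4 * real n + 1) \<le> sqrt (4 * (real n + 1))"
    by simp
  also have "\<dots> = 2 * real (Suc n) powr (1/2)"
    using real_sqrt_mult[of 4 "real n + 1"] by (simp add: powr_half_sqrt add.commute)
  also have "2 ^ r * (2 * real (Suc n) powr (1/2)) / (real n + 1)\<^sup>2 =
      2 ^ Suc r * (real (Suc n) powr (1/2) / real (Suc n) powr 2)"
    by (simp add: powr_numeral add.commute)
  also have "real (Suc n) powr (1/2) / real (Suc n) powr 2 = real (Suc n) powr (-3/2)"
    by (subst powr_diff [symmetric]) simp
  finally show "hyp_term \<alpha> c n $ r \<le> 2 ^ Suc r * real (Suc n) powr (-3/2)"
    by (simp add: mult_left_mono divide_right_mono)
qed

lemma summable_Suc_powr: "summable (\<lambda>n. C * real (Suc n) powr (-3/2))"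
  by (intro summable_mult iffD2[OF summable_Suc_iff]) (simp add: summable_real_powr_iff)

definition hyp_sum :: "real \<Rightarrow> real \<Rightarrow> real fps" where
  "hyp_sum \<alpha> c = Abs_fps (\<lambda>r. \<Sum>n. hyp_term \<alpha> c n $ r)"

lemma hyp_sum_sums:
  assumes "0 < \<alpha>" "\<alpha> < 1" "c \<ge> 1"
  shows "(\<lambda>n. hyp_term \<alpha> c n $ r) sums (hyp_sum \<alpha> c $ r)"
proof -
  have "summable (\<lambda>n. hyp_term \<alpha> c n $ r)"
    using hyp_term_nth_bounds[OF assms]
    by (intro summable_comparison_test'[OF summable_Suc_powr[of "2 ^ Suc r"], of 0]) auto
  then show ?thesis
    by (simp add: hyp_sum_def summable_sums)
qed

lemma hyp_sum_nth_bounds: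
  assumes "0 < \<alpha>" "\<alpha> < 1" "c \<ge> 1"
  shows "0 \<le> hyp_sum \<alpha> c $ r"
    and "hyp_sum \<alpha> c $ r \<le> (\<Sum>n. 2 ^ Suc r * real (Suc n) powr (-3/2))"
proof -
  show "0 \<le> hyp_sum \<alpha> c $ r"
    using hyp_sum_sums[OF assms] hyp_term_nth_bounds(1)[OF assms] by (rule sums_le[OF _ sums_zero, rotated])
  show "hyp_sum \<alpha> c $ r \<le> (\<Sum>n. 2 ^ Suc r * real (Suc n) powr (-3/2))"
    using hyp_term_nth_bounds(2)[OF assms] hyp_sum_sums[OF assms] summable_sums[OF summable_Suc_powr]
    by (rule sums_le)
qed

section \<open>Gauss's contiguous relation\<close>

text \<open>
  This is the contiguous relation between \<open>2F1(a, b; c; 1)\<close> and \<open>2F1(a, b; c + 1; 1)\<close> that underlies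
  Gauss's summation theorem, for \<open>a = \<alpha> - 1\<close> and \<open>b = -\<alpha>\<close> and with lower parameter \<open>c - 1 - X\<close>,
  after removal of the initial terms. The difference of the summands on both sides telescopes with certificate \<open>(n + 1) * hyp_term \<alpha> c n\<close>,
  multiplied by \<open>lin c\<close>. It tends to \<open>0\<close>, so only its initial value remains; this is the term
  \<open>lin c\<close> on the right.
\<close>

lemma hyp_sum_contiguous:
  assumes "0 < \<alpha>" "\<alpha> < 1" "c \<ge> 1"
  shows "lin (c - \<alpha>) * lin (c - 1 + \<alpha>) * hyp_sum \<alpha> (c + 1) = (lin c)\<^sup>2 * hyp_sum \<alpha> c - lin c"
proof (rule fps_ext)
  fix r
  let ?g = "\<lambda>n. of_nat (Suc n) * hyp_term \<alpha> c n"
  let ?K = "lin (c - \<alpha>) * lin (c - 1 + \<alpha>)"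
  have c: "c > 0"
    using assms by simp
  have tele: "?K * hyp_term \<alpha> (c + 1) n - (lin c)\<^sup>2 * hyp_term \<alpha> c n = lin c * (?g (Suc n) - ?g n)" for n
  proof -
    define R where "R = inv_poch c (Suc n)"
    define a where "a = fps_const \<alpha>"
    define w where "w = fps_const (hyp_coeff \<alpha> n)"
    define L where "L = lin c"
    \<comment> \<open>All three summands are multiples of the same reciprocal \<open>R\<close>; what is left is a polynomial identity.\<close>
    have 1: "hyp_term \<alpha> c n = w * (R * (L + of_nat n))"
      using inv_poch_Suc[OF c, of n]
      by (simp add: hyp_term_def w_def R_def L_def lin_def fps_of_nat [symmetric] algebra_simps
               del: fps_const_add flip: fps_const_add)
    have 2: "hyp_term \<alpha> (c + 1) n = w * (R * L)"
      using inv_poch_shift[OF c, of n] by (simp add: hyp_term_def w_def R_def L_def)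
    have "of_nat (Suc (Suc n)) * fps_const (hyp_coeff \<alpha> (Suc n)) = fps_const ((real n + 2) * hyp_coeff \<alpha> (Suc n))"
      by (simp add: fps_of_nat [symmetric] add.commute)
    also have "\<dots> = (a + of_nat n) * (1 - a + of_nat n) * w"
      unfolding hyp_coeff_Suc a_def w_def by (simp add: fps_of_nat [symmetric])
    finally have 3: "?g (Suc n) = (a + of_nat n) * (1 - a + of_nat n) * w * R"
      by (simp add: hyp_term_def R_def mult.assoc [symmetric])
    have 4: "lin (c - \<alpha>) = L - a" "lin (c - 1 + \<alpha>) = L - 1 + a"
      by (simp_all add: L_def a_def lin_def fps_const_sub [symmetric] fps_const_add [symmetric]
                  del: fps_const_sub fps_const_add)
    show ?thesis
      unfolding 1 2 3 4 L_def [symmetric] by (simp add: algebra_simps power2_eq_square)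
  qed
  have g0: "(\<lambda>n. ?g n $ i) \<longlonglongrightarrow> 0" for i
  proof (rule tendsto_sandwich)
    have nth: "?g n $ i = real (Suc n) * hyp_term \<alpha> c n $ i" for n
      by (simp only: fps_of_nat [symmetric] fps_mult_left_const_nth)
    show "\<forall>\<^sub>F n in sequentially. 0 \<le> ?g n $ i"
      unfolding nth using hyp_term_nth_bounds(1)[OF assms] by (intro always_eventually) simp
    show "\<forall>\<^sub>F n in sequentially. ?g n $ i \<le> 2 ^ Suc i * real (Suc n) powr (-1/2)"
    proof (intro always_eventually allI)
      fix n
      have "?g n $ i \<le> real (Suc n) * (2 ^ Suc i * real (Suc n) powr (-3/2))"
        unfolding nth using hyp_term_nth_bounds(2)[OF assms] by (intro mult_left_mono) auto
      also have "\<dots> = 2 ^ Suc i * (real (Suc n) powr 1 * real (Suc n) powr (-3/2))"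
        by simp
      also have "real (Suc n) powr 1 * real (Suc n) powr (-3/2) = real (Suc n) powr (-1/2)"
        by (subst powr_add [symmetric]) simp
      finally show "?g n $ i \<le> 2 ^ Suc i * real (Suc n) powr (-1/2)" .
    qed
    have "(\<lambda>n. real (Suc n) powr (-1/2)) \<longlonglongrightarrow> 0"
      by (intro tendsto_neg_powr filterlim_compose[OF filterlim_real_sequentially filterlim_Suc]) auto
    then show "(\<lambda>n. 2 ^ Suc i * real (Suc n) powr (-1/2)) \<longlonglongrightarrow> 0"
      by (rule tendsto_mult_right_zero)
  qed simp
  have "(\<lambda>n. (lin c * (?g (Suc n) - ?g n)) $ r) sums ((lin c * (- 1)) $ r)"
  proof (rule sums_fps_mult_left_nth)
    fix i
    have "(\<lambda>n. ?g (Suc n) $ i - ?g n $ i) sums (0 - ?g 0 $ i)"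
      by (rule telescope_sums[OF g0])
    then show "(\<lambda>n. (?g (Suc n) - ?g n) $ i) sums ((- 1) $ i)"
      by (simp add: hyp_term_def)
  qed
  moreover have "(\<lambda>n. (?K * hyp_term \<alpha> (c + 1) n) $ r - ((lin c)\<^sup>2 * hyp_term \<alpha> c n) $ r) sums
      ((?K * hyp_sum \<alpha> (c + 1)) $ r - ((lin c)\<^sup>2 * hyp_sum \<alpha> c) $ r)"
    using assms by (intro sums_diff sums_fps_mult_left_nth hyp_sum_sums) auto
  ultimately have "(?K * hyp_sum \<alpha> (c + 1)) $ r - ((lin c)\<^sup>2 * hyp_sum \<alpha> c) $ r = (lin c * (- 1)) $ r"
    unfolding fps_sub_nth [symmetric] tele by (rule sums_unique2 [OF _ , rotated])
  then show "(?K * hyp_sum \<alpha> (c + 1)) $ r = ((lin c)\<^sup>2 * hyp_sum \<alpha> c - lin c) $ r"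
    by simp
qed

text \<open>
  This is \<open>(c - 1 - X) 2F1(\<alpha> - 1, -\<alpha>; c - 1 - X; 1)\<close>. The factor in front cancels the lower parameter
  from the denominators, so that the expression makes sense at \<open>c = 1\<close>, where that parameter is \<open>-X\<close>
  and hence not invertible. The initial term of the series contributes \<open>lin (c - 1)\<close>.
\<close>

definition gauss_fps :: "real \<Rightarrow> real \<Rightarrow> real fps" where
  "gauss_fps \<alpha> c = fps_const (\<alpha> * (1 - \<alpha>)) * hyp_sum \<alpha> c + lin (c - 1)"

lemma gauss_fps_contiguous:
  assumes "0 < \<alpha>" "\<alpha> < 1" "c \<ge> 1"
  shows "(lin c)\<^sup>2 * gauss_fps \<alpha> c = lin (c - \<alpha>) * lin (c - 1 + \<alpha>) * gauss_fps \<alpha> (c + 1)"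
proof -
  define L where "L = lin c"
  define a where "a = fps_const \<alpha>"
  define H H' where "H = hyp_sum \<alpha> c" and "H' = hyp_sum \<alpha> (c + 1)"
  have L: "lin (c - \<alpha>) = L - a" "lin (c - 1 + \<alpha>) = L - 1 + a" "lin (c - 1) = L - 1" "lin (c + 1 - 1) = L"
    by (simp_all add: L_def a_def lin_def fps_const_sub [symmetric] fps_const_add [symmetric]
                del: fps_const_sub fps_const_add)
  have A: "fps_const (\<alpha> * (1 - \<alpha>)) = a * (1 - a)"
    by (simp add: a_def)
  have "(L - a) * (L - 1 + a) * H' = L\<^sup>2 * H - L"
    using hyp_sum_contiguous[OF assms] unfolding L L_def [symmetric] H_def H'_def .
  then have "a * (1 - a) * ((L - a) * (L - 1 + a) * H') = a * (1 - a) * (L\<^sup>2 * H - L)"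
    by simp
  then show ?thesis
    unfolding gauss_fps_def L A H_def [symmetric] H'_def [symmetric] L_def [symmetric]
    by (simp add: algebra_simps power2_eq_square)
qed

lemma gauss_fps_iterate:
  assumes "0 < \<alpha>" "\<alpha> < 1"
  shows "(\<Prod>k<N. lin (1 + real k))\<^sup>2 * gauss_fps \<alpha> 1 =
           (\<Prod>k<N. lin (1 - \<alpha> + real k)) * (\<Prod>k<N. lin (\<alpha> + real k)) * gauss_fps \<alpha> (1 + real N)"
proof (induction N)
  case (Suc N)
  let ?L = "\<Prod>k<N. lin (1 + real k)" and ?c = "1 + real N"
  let ?R = "(\<Prod>k<N. lin (1 - \<alpha> + real k)) * (\<Prod>k<N. lin (\<alpha> + real k))"
  have "(\<Prod>k<Suc N. lin (1 + real k))\<^sup>2 * gauss_fps \<alpha> 1 = (lin ?c)\<^sup>2 * (?L\<^sup>2 * gauss_fps \<alpha> 1)"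
    by (simp add: power_mult_distrib mult_ac)
  also have "\<dots> = ?R * ((lin ?c)\<^sup>2 * gauss_fps \<alpha> ?c)"
    unfolding Suc.IH by (simp only: mult_ac)
  also have "(lin ?c)\<^sup>2 * gauss_fps \<alpha> ?c = lin (1 - \<alpha> + real N) * lin (\<alpha> + real N) * gauss_fps \<alpha> (1 + real (Suc N))"
    using assms by (subst gauss_fps_contiguous) (simp_all add: algebra_simps)
  finally show ?case
    by (simp only: prod.lessThan_Suc mult_ac)
qed simp

section \<open>From finite products to Bell polynomials\<close>

lemma prod_lin:
  assumes "c > 0"
  shows "(\<Prod>k<N. lin (c + real k)) = fps_const (pochhammer c N) *
           bell_gf (\<lambda>j. - (fact (j - 1) * (\<Sum>k<N. (1 / (c + real k)) ^ j)))"
proof -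
  have "lin (c + real k) = fps_const (c + real k) * bell_gf (\<lambda>j. - (fact (j - 1) * (1 / (c + real k)) ^ j))" for k
    unfolding bell_gf_neg_power using assms
    by (auto simp: fps_eq_iff lin_nth right_diff_distrib mult.assoc [symmetric])
  then have "(\<Prod>k<N. lin (c + real k)) = (\<Prod>k<N. fps_const (c + real k)) *
      bell_gf (\<lambda>j. \<Sum>k<N. - (fact (j - 1) * (1 / (c + real k)) ^ j))"
    by (simp add: bell_gf_sum prod.distrib)
  also have "(\<Prod>k<N. fps_const (c + real k)) = fps_const (pochhammer c N)"
    by (induction N) (simp_all add: pochhammer_Suc)
  finally show ?thesis
    by (simp add: sum_negf sum_distrib_left)
qed

lemma inv_poch_1: "inv_poch 1 n $ r = bell_harm r n / (fact n * fact r)"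
proof -
  let ?x = "\<lambda>j. fact (j - 1) * (\<Sum>k<n. (1 / (1 + real k)) ^ j)"
  have gh: "gen_harm j n = (\<Sum>k<n. (1 / (1 + real k)) ^ j)" for j
    unfolding gen_harm_def
    by (simp add: sum.atLeast1_atMost_eq power_one_over add.commute)
  have "inv_poch 1 n * (\<Prod>k<n. lin (1 + real k)) = 1"
    unfolding inv_poch_def prod.distrib [symmetric] by (intro prod.neutral) (simp add: lin_inverse)
  then have "inv_poch 1 n * (fps_const (fact n) * bell_gf (\<lambda>j. - ?x j)) = 1"
    by (simp add: prod_lin pochhammer_fact)
  moreover have "bell_gf (\<lambda>j. - ?x j) * bell_gf ?x = 1"
    by (simp add: bell_gf_add [symmetric])
  ultimately have "fps_const (fact n) * inv_poch 1 n = bell_gf ?x"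
    by (metis (no_types, lifting) mult.assoc mult.commute mult_1)
  then have "fact n * inv_poch 1 n $ r = bell_gf ?x $ r"
    by (metis fps_mult_left_const_nth)
  then show ?thesis
    by (simp add: bell_gf_nth bell_harm_def gh field_simps)
qed

text \<open>
  Up to the sign \<open>(-1)^j\<close>, these are the partial sums of the series for \<open>Delta \<alpha> j\<close>.
\<close>

definition delta_partial :: "real \<Rightarrow> nat \<Rightarrow> nat \<Rightarrow> real" where
  "delta_partial \<alpha> N j = fact (j - 1) * (2 * (\<Sum>k<N. (1 / (1 + real k)) ^ j)
     - (\<Sum>k<N. (1 / (1 - \<alpha> + real k)) ^ j) - (\<Sum>k<N. (1 / (\<alpha> + real k)) ^ j))"

text \<open>
  For \<open>j = 1\<close> the three sums diverge separately. Comparing each of them with \<open>ln N\<close> gives the digamma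
  values, and the logarithms cancel because the weights \<open>2, -1, -1\<close> add up to \<open>0\<close>.
\<close>

lemma delta_partial_tendsto:
  assumes "0 < \<alpha>" "\<alpha> < 1" "j \<ge> 1"
  shows "(\<lambda>N. delta_partial \<alpha> N j) \<longlonglongrightarrow> (-1) ^ j * Delta \<alpha> j"
proof (cases "j = 1")
  case True
  let ?D = "\<lambda>z N. ln (real N) - (\<Sum>k<N. 1 / (z + real k))"
  have D: "?D z \<longlonglongrightarrow> Digamma z" if "z > 0" for z :: real
    using Digamma_LIMSEQ[of z] that by (simp add: inverse_eq_divide)
  have "(\<lambda>N. ?D (1 - \<alpha>) N + ?D \<alpha> N - 2 * ?D 1 N) \<longlonglongrightarrow> Digamma (1 - \<alpha>) + Digamma \<alpha> - 2 * Digamma 1"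
    using assms by (intro tendsto_intros D) auto
  also have "(\<lambda>N. ?D (1 - \<alpha>) N + ?D \<alpha> N - 2 * ?D 1 N) = (\<lambda>N. delta_partial \<alpha> N j)"
    by (simp add: fun_eq_iff delta_partial_def True)
  finally show ?thesis
    by (simp add: Delta_def True algebra_simps)
next
  case False
  define n where "n = j - 1"
  have j: "j = Suc n" "n > 0"
    using False assms by (auto simp: n_def)
  have S: "(\<lambda>N. \<Sum>k<N. (1 / (z + real k)) ^ j) \<longlonglongrightarrow> (-1) ^ j * Polygamma n z / fact n" if "z > 0" for z :: real
    using Polygamma_LIMSEQ[of z n] that j by (simp add: sums_def power_one_over inverse_eq_divide)
  have "(\<lambda>N. delta_partial \<alpha> N j) \<longlonglongrightarrow> fact (j - 1) * (2 * ((-1) ^ j * Polygamma n 1 / fact n)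
      - (-1) ^ j * Polygamma n (1 - \<alpha>) / fact n - (-1) ^ j * Polygamma n \<alpha> / fact n)"
    (is "_ \<longlonglongrightarrow> ?l")
    unfolding delta_partial_def using assms by (intro tendsto_intros S) auto
  also have "?l = (-1) ^ j * Delta \<alpha> j"
    by (simp add: Delta_def j field_simps)
  finally show ?thesis .
qed

section \<open>The limit of the iterated relation\<close>

text \<open>
  By Euler's limit formula for the Gamma function the limit is \<open>1 / (\<Gamma>(\<alpha>) \<Gamma>(1 - \<alpha>))\<close>, which the
  reflection formula evaluates.
\<close>

lemma pochhammer_reflection_tendsto:
  assumes "0 < \<alpha>" "\<alpha> < 1"
  shows "(\<lambda>N. real N * pochhammer \<alpha> N * pochhammer (1 - \<alpha>) N / (fact N)\<^sup>2) \<longlonglongrightarrow> sin (pi * \<alpha>) / pi"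
proof -
  have "complex_of_real (Gamma \<alpha> * Gamma (1 - \<alpha>)) = complex_of_real (pi / sin (pi * \<alpha>))"
  proof -
    have "1 - complex_of_real \<alpha> = of_real (1 - \<alpha>)"
      by simp
    then show ?thesis
      using Gamma_reflection_complex[of "of_real \<alpha>"]
      by (simp only: Gamma_complex_of_real sin_of_real of_real_mult [symmetric] of_real_divide [symmetric])
  qed
  then have refl: "Gamma \<alpha> * Gamma (1 - \<alpha>) = pi / sin (pi * \<alpha>)"
    by (simp only: of_real_eq_iff)
  have "Gamma \<alpha> > 0" "Gamma (1 - \<alpha>) > 0"
    using assms by (auto intro: Gamma_real_pos)
  then have nz: "Gamma \<alpha> * Gamma (1 - \<alpha>) \<noteq> 0"
    by simp
  have "(\<lambda>N. inverse (Gamma_series' \<alpha> N * Gamma_series' (1 - \<alpha>) N)) \<longlonglongrightarrow> inverse (Gamma \<alpha> * Gamma (1 - \<alpha>))"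
    by (intro tendsto_intros Gamma_series'_LIMSEQ nz)
  moreover have "\<forall>\<^sub>F N in sequentially. inverse (Gamma_series' \<alpha> N * Gamma_series' (1 - \<alpha>) N) =
      real N * pochhammer \<alpha> N * pochhammer (1 - \<alpha>) N / (fact N)\<^sup>2"
    using eventually_gt_at_top[of 0]
  proof eventually_elim
    case (elim N)
    then obtain M where M: "N = Suc M"
      by (cases N) auto
    have "exp (\<alpha> * ln (real N)) * exp ((1 - \<alpha>) * ln (real N)) = real N"
      using elim by (simp add: exp_add [symmetric] algebra_simps)
    then have "Gamma_series' \<alpha> N * Gamma_series' (1 - \<alpha>) N =
        (fact (N - 1))\<^sup>2 * real N / (pochhammer \<alpha> N * pochhammer (1 - \<alpha>) N)"
      by (simp add: Gamma_series'_def power2_eq_square field_simps)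
    then show ?case
      by (simp add: M power2_eq_square field_simps del: of_nat_Suc)
  qed
  ultimately show ?thesis
    by (simp add: Lim_transform_eventually refl)
qed

text \<open>
  The coefficients of \<open>hyp_sum \<alpha> c\<close> are bounded uniformly in \<open>c\<close>, so only the summand \<open>N - X\<close> of
  \<open>gauss_fps \<alpha> (1 + N)\<close> survives division by \<open>N\<close>.
\<close>

lemma gauss_fps_asymptotic:
  assumes "0 < \<alpha>" "\<alpha> < 1"
  shows "(\<lambda>N. (fps_const (1 / real N) * gauss_fps \<alpha> (1 + real N)) $ r) \<longlonglongrightarrow> 1 $ r"
proof -
  let ?B = "\<Sum>n. 2 ^ Suc r * real (Suc n) powr (-3/2)"
  have inv: "(\<lambda>N. 1 / real N) \<longlonglongrightarrow> 0"
    by (rule lim_1_over_n)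
  have H: "(\<lambda>N. hyp_sum \<alpha> (1 + real N) $ r / real N) \<longlonglongrightarrow> 0"
  proof (rule tendsto_sandwich)
    show "\<forall>\<^sub>F N in sequentially. 0 \<le> hyp_sum \<alpha> (1 + real N) $ r / real N"
      using assms hyp_sum_nth_bounds(1) by (intro always_eventually) simp
    show "\<forall>\<^sub>F N in sequentially. hyp_sum \<alpha> (1 + real N) $ r / real N \<le> ?B * (1 / real N)"
      using assms hyp_sum_nth_bounds(2) by (intro always_eventually) (simp add: divide_right_mono)
    show "(\<lambda>N. ?B * (1 / real N)) \<longlonglongrightarrow> 0"
      by (rule tendsto_mult_right_zero[OF inv])
  qed simp
  have "(\<lambda>N. lin (real N) $ r / real N) \<longlonglongrightarrow> 1 $ r"
  proof (cases "r = 0")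
    case True
    have "\<forall>\<^sub>F N in sequentially. 1 = real N / real N"
      using eventually_gt_at_top[of 0] by eventually_elim simp
    then show ?thesis
      using True by (simp add: lin_nth tendsto_eventually eventually_mono)
  next
    case False
    then show ?thesis
      using inv tendsto_minus[OF inv] by (cases "r = 1") (simp_all add: lin_nth)
  qed
  then have "(\<lambda>N. \<alpha> * (1 - \<alpha>) * (hyp_sum \<alpha> (1 + real N) $ r / real N) + lin (real N) $ r / real N)
      \<longlonglongrightarrow> \<alpha> * (1 - \<alpha>) * 0 + 1 $ r"
    by (intro tendsto_intros H)
  then show ?thesis
    by (simp add: gauss_fps_def add_divide_distrib)
qed

text \<open>
  The factors \<open>N\<close> and \<open>1 / N\<close> are inserted so that each of the three parts converges.
\<close>

lemma gauss_fps_factorization: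
  assumes "0 < \<alpha>" "\<alpha> < 1" "N > 0"
  shows "gauss_fps \<alpha> 1 = fps_const (real N * pochhammer \<alpha> N * pochhammer (1 - \<alpha>) N / (fact N)\<^sup>2) *
           (bell_gf (delta_partial \<alpha> N) * (fps_const (1 / real N) * gauss_fps \<alpha> (1 + real N)))"
proof -
  let ?s = "\<lambda>c j. fact (j - 1) * (\<Sum>k<N. (1 / (c + real k)) ^ j) :: real"
  let ?E = "\<lambda>c. bell_gf (\<lambda>j. - ?s c j)" and ?E1 = "bell_gf (?s 1)"
  have E1: "?E1 * ?E 1 = 1"
    by (simp add: bell_gf_add [symmetric])
  have "bell_gf (\<lambda>j. ?s 1 j + ?s 1 j + - ?s (1 - \<alpha>) j + - ?s \<alpha> j) = ?E1 * ?E1 * ?E (1 - \<alpha>) * ?E \<alpha>"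
    by (simp only: bell_gf_add)
  also have "(\<lambda>j. ?s 1 j + ?s 1 j + - ?s (1 - \<alpha>) j + - ?s \<alpha> j) = delta_partial \<alpha> N"
    by (simp add: fun_eq_iff delta_partial_def algebra_simps)
  finally have D: "bell_gf (delta_partial \<alpha> N) = ?E1\<^sup>2 * (?E (1 - \<alpha>) * ?E \<alpha>)"
    by (simp add: power2_eq_square mult_ac)
  define p q f where "p = fps_const (pochhammer \<alpha> N)" and "q = fps_const (pochhammer (1 - \<alpha>) N)"
    and "f = fps_const (1 / (fact N)\<^sup>2 :: real)"
  have f: "f * (fps_const (fact N))\<^sup>2 = 1"
    by (simp add: f_def power2_eq_square)
  have "(fps_const (fact N) * ?E 1)\<^sup>2 * gauss_fps \<alpha> 1 =
      (q * ?E (1 - \<alpha>)) * (p * ?E \<alpha>) * gauss_fps \<alpha> (1 + real N)"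
    using gauss_fps_iterate[OF assms(1,2), of N] assms
    by (simp add: prod_lin pochhammer_fact p_def q_def)
  then have "f * ?E1\<^sup>2 * ((fps_const (fact N) * ?E 1)\<^sup>2 * gauss_fps \<alpha> 1) =
      f * ?E1\<^sup>2 * ((q * ?E (1 - \<alpha>)) * (p * ?E \<alpha>) * gauss_fps \<alpha> (1 + real N))"
    by (rule arg_cong)
  moreover have "f * ?E1\<^sup>2 * ((fps_const (fact N) * ?E 1)\<^sup>2 * gauss_fps \<alpha> 1) =
      (f * (fps_const (fact N))\<^sup>2) * (?E1 * ?E 1)\<^sup>2 * gauss_fps \<alpha> 1"
    by (simp only: power_mult_distrib mult_ac)
  ultimately have "gauss_fps \<alpha> 1 = f * p * q * (bell_gf (delta_partial \<alpha> N) * gauss_fps \<alpha> (1 + real N))"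
    unfolding f E1 D by (simp only: mult_ac mult_1 power_one)
  also have "f * p * q = fps_const (real N * pochhammer \<alpha> N * pochhammer (1 - \<alpha>) N / (fact N)\<^sup>2) * fps_const (1 / real N)"
    using assms(3) by (simp add: f_def p_def q_def)
  finally show ?thesis
    by (simp only: mult_ac)
qed

text \<open>
  This is Gauss's evaluation \<open>\<Gamma>(1 - X)^2 / (\<Gamma>(1 - \<alpha> - X) \<Gamma>(\<alpha> - X))\<close>, expanded in \<open>X\<close>.
\<close>

lemma gauss_fps_nth:
  assumes "0 < \<alpha>" "\<alpha> < 1"
  shows "gauss_fps \<alpha> 1 $ r = sin (pi * \<alpha>) / pi * ((-1) ^ r * bell_poly r (Delta \<alpha>) / fact r)"
proof -
  let ?D = "\<lambda>j. (-1) ^ j * Delta \<alpha> j"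
  let ?C = "\<lambda>N. real N * pochhammer \<alpha> N * pochhammer (1 - \<alpha>) N / (fact N)\<^sup>2"
  let ?R = "\<lambda>N. bell_gf (delta_partial \<alpha> N) * (fps_const (1 / real N) * gauss_fps \<alpha> (1 + real N))"
  have "(\<lambda>N. ?C N * ?R N $ r) \<longlonglongrightarrow> sin (pi * \<alpha>) / pi * (bell_gf ?D * 1) $ r"
    using assms
    by (intro tendsto_mult pochhammer_reflection_tendsto tendsto_fps_mult_nth tendsto_bell_gf_nth
              gauss_fps_asymptotic delta_partial_tendsto)
  moreover have "\<forall>\<^sub>F N in sequentially. ?C N * ?R N $ r = gauss_fps \<alpha> 1 $ r"
    using eventually_gt_at_top[of 0]
    by eventually_elim (subst gauss_fps_factorization[OF assms], auto simp only: fps_mult_left_const_nth)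
  ultimately have "(\<lambda>N. gauss_fps \<alpha> 1 $ r) \<longlonglongrightarrow> sin (pi * \<alpha>) / pi * (bell_gf ?D * 1) $ r"
    by (rule Lim_transform_eventually)
  then have "gauss_fps \<alpha> 1 $ r = sin (pi * \<alpha>) / pi * (bell_gf ?D * 1) $ r"
    by (rule LIMSEQ_unique[OF tendsto_const])
  then show ?thesis
    by (simp add: bell_gf_nth bell_poly_alternate)
qed

theorem theorem5p1:
  fixes \<alpha> :: real and r :: nat
  assumes "0 < \<alpha>" and "\<alpha> < 1"
  shows "(\<lambda>n. pochhammer \<alpha> n * pochhammer (1 - \<alpha>) n / (fact n)\<^sup>2 * (bell_harm r n / (real n + 1)))
           sums (1 / (\<alpha> * (1 - \<alpha>)) *
             ((if r = 1 then 1 else 0) + (-1) ^ r * (sin (pi * \<alpha>) / pi) * bell_poly r (Delta \<alpha>)))"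
proof -
  have "(\<lambda>n. fact r * hyp_term \<alpha> 1 n $ r) sums (fact r * hyp_sum \<alpha> 1 $ r)"
    using assms by (intro sums_mult hyp_sum_sums) auto
  also have "(\<lambda>n. fact r * hyp_term \<alpha> 1 n $ r) =
      (\<lambda>n. pochhammer \<alpha> n * pochhammer (1 - \<alpha>) n / (fact n)\<^sup>2 * (bell_harm r n / (real n + 1)))"
    by (simp add: fun_eq_iff hyp_term_def hyp_coeff_def inv_poch_1 power2_eq_square add.commute mult_ac)
  also have "fact r * hyp_sum \<alpha> 1 $ r = 1 / (\<alpha> * (1 - \<alpha>)) *
      ((if r = 1 then 1 else 0) + (-1) ^ r * (sin (pi * \<alpha>) / pi) * bell_poly r (Delta \<alpha>))"
  proof -
    have "\<alpha> * (1 - \<alpha>) * hyp_sum \<alpha> 1 $ r = (if r = 1 then 1 else 0) + gauss_fps \<alpha> 1 $ r"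
      by (simp add: gauss_fps_def lin_nth)
    then have "\<alpha> * (1 - \<alpha>) * (fact r * hyp_sum \<alpha> 1 $ r) =
        (if r = 1 then 1 else 0) + fact r * gauss_fps \<alpha> 1 $ r"
      unfolding mult.left_commute[of _ "fact r"] by (simp add: distrib_left)
    also have "fact r * gauss_fps \<alpha> 1 $ r = (-1) ^ r * (sin (pi * \<alpha>) / pi) * bell_poly r (Delta \<alpha>)"
      by (simp add: gauss_fps_nth[OF assms])
    finally show ?thesis
      using assms by (simp add: nonzero_eq_divide_eq mult.commute)
  qed
  finally show ?thesis .
qed

end
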